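(* Let $\phi\in C^2([0,\infty))$ be a positive, decreasing, convex function such that $\phi(0)=-\phi'(0)=1$ and $\phi(t)\leq 1-t+\frac{t^2}{2}$ for all $t\geq 0$. Let $\{e^{tA}\}_{t\geq0}$ be a strongly continuous semigroup, with generator $A$, on a Banach space $X$ with norm $\|\cdot\|$. Suppose that for some $f\in\mathbf{D}(A^2)\setminus\{0\}$ and some $\omega>0$, and for all $t\geq0$, $$\|e^{tA}f\|\leq \phi(\omega t)\|f\|\quad\text{and}\quad \|e^{tA}A^2f\|\leq \phi''(\omega t)\|A^2f\|.$$ Set $$a=\|f\|,\quad b=\frac{\|Af\|}{\omega}\quad\text{and}\quad c=\frac{\|A^2f\|}{\omega^2}.$$ Then $$\phi(s)(a+c)+s(c-b)+(a-c)\geq0\quad\text{for all } s\geq0.$$ In particular, $$b^2\leq 4ac.$$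
   Context: For a strongly continuous semigroup $\{e^{tA}\}_{t\geq 0}$ of bounded linear operators on a Banach space $X$, $A$ denotes its (in general unbounded) infinitesimal generator with domain $\mathbf{D}(A)$, and $\mathbf{D}(A^2)=\{f\in\mathbf{D}(A): Af\in\mathbf{D}(A)\}$. The semigroup is not assumed contractive. *)

theory Defs
  imports "HOL-Analysis.Analysis"
begin

text \<open>
  Only the values \<open>T t\<close> with \<open>t \<ge> 0\<close> matter. The class \<open>banach\<close> consists of
  real Banach spaces; a complex Banach space is in particular a real one, and restricting
  scalars changes neither a semigroup nor its generator.
\<close>

definition strongly_continuous_semigroup :: "(real \<Rightarrow> 'a::banach \<Rightarrow>\<^sub>L 'a) \<Rightarrow> bool" where
  "strongly_continuous_semigroup T \<longleftrightarrow>
     T 0 = id_blinfun \<and>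
     (\<forall>s\<ge>0. \<forall>t\<ge>0. T (s + t) = T s o\<^sub>L T t) \<and>
     (\<forall>x. continuous_on {0..} (\<lambda>t. blinfun_apply (T t) x))"

definition generator_domain :: "(real \<Rightarrow> 'a::banach \<Rightarrow>\<^sub>L 'a) \<Rightarrow> 'a set" where
  "generator_domain T =
     {x. \<exists>y. ((\<lambda>t. (blinfun_apply (T t) x - x) /\<^sub>R t) \<longlongrightarrow> y) (at_right 0)}"

text \<open>The value of \<open>generator T\<close> is meaningful only on \<open>generator_domain T\<close>.\<close>

definition generator :: "(real \<Rightarrow> 'a::banach \<Rightarrow>\<^sub>L 'a) \<Rightarrow> 'a \<Rightarrow> 'a" where
  "generator T x = Lim (at_right 0) (\<lambda>t. (blinfun_apply (T t) x - x) /\<^sub>R t)"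

definition generator_sq_domain :: "(real \<Rightarrow> 'a::banach \<Rightarrow>\<^sub>L 'a) \<Rightarrow> 'a set" where
  "generator_sq_domain T = {x \<in> generator_domain T. generator T x \<in> generator_domain T}"

end

theory Submission
  imports Defs
begin

text \<open>
  Write \<open>T t\<close> for the semigroup. The Taylor formula
  \<open>T t f = f + t A f + (integral over 0 \<le> s \<le> t of (t - s) T s A\<^sup>2 f)\<close>
  has a remainder that is controlled by the same formula for \<open>\<phi>\<close>: the bound on
  \<open>T s A\<^sup>2 f\<close> makes the norm of the remainder at most
  \<open>c (\<phi> s - 1 + s)\<close>, where now \<open>s = \<omega> t\<close>. Since \<open>T t f\<close> has norm at most \<open>\<phi> s a\<close>,
  the triangle inequality applied to \<open>f + t A f\<close> gives both
  \<open>s b \<le> a + \<phi> s a + c (\<phi> s - 1 + s)\<close> and \<open>a \<le> s b + \<phi> s a + c (\<phi> s - 1 + s)\<close>.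
  The first one is the asserted inequality.

  For \<open>b\<^sup>2 \<le> 4ac\<close> it is not enough to optimise the first inequality after inserting
  \<open>\<phi> s \<le> 1 - s + s\<^sup>2 / 2\<close>; one also needs \<open>a \<le> c\<close>. Letting \<open>s \<rightarrow> 0\<close> in the second
  inequality gives \<open>a \<le> b\<close>, and letting \<open>s \<rightarrow> \<infinity>\<close> in the first gives \<open>b \<le> c\<close>. Then
  \<open>s = 2 sqrt (a / c)\<close> satisfies \<open>s \<le> 2\<close>, and the first inequality at this \<open>s\<close> reads
  \<open>b \<le> 2 sqrt (a c)\<close>.

  The remainder is estimated without integrals, by a mean value inequality that uses
  right derivatives only. The right derivative of an orbit of the semigroup is immediate
  from the definition of the generator, whereas the usual treatment of the left derivative
  needs local boundedness of the operator norms, hence the uniform boundedness principle.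
\<close>

section \<open>A mean value inequality for right derivatives\<close>

text \<open>
  For each \<open>\<epsilon> > 0\<close> the inequality with the additional slack \<open>\<epsilon> (x - a)\<close> holds
  at a last point of the interval; if this were not the right end point, the right
  derivatives there would carry the inequality a little further.
\<close>

lemma norm_diff_le_of_right_derivative_le:
  fixes u :: "real \<Rightarrow> 'a::real_normed_vector" and h :: "real \<Rightarrow> real"
  assumes "a \<le> b"
    and cont_u: "continuous_on {a..b} u" and cont_h: "continuous_on {a..b} h"
    and du: "\<And>x. a \<le> x \<Longrightarrow> x < b \<Longrightarrow> (u has_vector_derivative u' x) (at_right x)"
    and dh: "\<And>x. a \<le> x \<Longrightarrow> x < b \<Longrightarrow> (h has_real_derivative h' x) (at_right x)"
    and le: "\<And>x. a \<le> x \<Longrightarrow> x < b \<Longrightarrow> norm (u' x) \<le> h' x"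
  shows "norm (u b - u a) \<le> h b - h a"
proof (rule field_le_epsilon)
  fix e :: real assume "e > 0"
  define \<epsilon> where "\<epsilon> = e / (b - a + 1)"
  have "\<epsilon> > 0" "\<epsilon> * (b - a) \<le> e"
    using \<open>e > 0\<close> \<open>a \<le> b\<close> by (auto simp: \<epsilon>_def field_simps)
  define k where "k x = norm (u x - u a) - (h x - h a) - \<epsilon> * (x - a)" for x
  define S where "S = {x \<in> {a..b}. k x \<le> 0}"
  have "continuous_on {a..b} k"
    unfolding k_def by (intro continuous_intros cont_u cont_h)
  then have "closed S"
    unfolding S_def by (intro continuous_on_closed_Collect_le) (auto intro: continuous_intros)
  then have "compact S"
    by (rule compact_eq_bounded_closed[THEN iffD2, OF conjI, rotated])
       (auto simp: S_def intro: bounded_subset[of "{a..b}"])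
  moreover have "a \<in> S"
    using \<open>a \<le> b\<close> by (simp add: S_def k_def)
  ultimately obtain c where c: "c \<in> S" "\<And>x. x \<in> S \<Longrightarrow> x \<le> c"
    using compact_attains_sup[of S] by auto
  have "c = b"
  proof (rule ccontr)
    assume "c \<noteq> b"
    with c(1) have "a \<le> c" "c < b" "k c \<le> 0"
      by (auto simp: S_def)
    obtain d1 where "d1 > 0" and d1: "\<And>y. y > c \<Longrightarrow> norm (y - c) < d1 \<Longrightarrow>
        norm (u y - u c - (y - c) *\<^sub>R u' c) \<le> \<epsilon> / 2 * norm (y - c)"
      using du[OF \<open>a \<le> c\<close> \<open>c < b\<close>] \<open>\<epsilon> > 0\<close>
      unfolding has_vector_derivative_def has_derivative_within_alt
      by (metis greaterThan_iff half_gt_zero)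
    obtain d2 where "d2 > 0" and d2: "\<And>y. y > c \<Longrightarrow> norm (y - c) < d2 \<Longrightarrow>
        norm (h y - h c - h' c * (y - c)) \<le> \<epsilon> / 2 * norm (y - c)"
      using dh[OF \<open>a \<le> c\<close> \<open>c < b\<close>] \<open>\<epsilon> > 0\<close>
      unfolding has_field_derivative_def has_derivative_within_alt
      by (metis greaterThan_iff half_gt_zero)
    define y where "y = c + min (b - c) (min d1 d2) / 2"
    have y: "y > c" "y \<le> b" "norm (y - c) < d1" "norm (y - c) < d2"
      using \<open>c < b\<close> \<open>d1 > 0\<close> \<open>d2 > 0\<close> by (auto simp: y_def min_def field_simps)
    have "norm (u y - u c) \<le> norm ((y - c) *\<^sub>R u' c) + \<epsilon> / 2 * (y - c)"
      using d1[OF y(1,3)] y(1) norm_triangle_sub[of "u y - u c" "(y - c) *\<^sub>R u' c"] by simp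
    also have "norm ((y - c) *\<^sub>R u' c) \<le> (y - c) * h' c"
      using le[OF \<open>a \<le> c\<close> \<open>c < b\<close>] y(1) by (simp add: mult_left_mono)
    finally have "norm (u y - u c) \<le> h' c * (y - c) + \<epsilon> / 2 * (y - c)"
      by (simp add: mult.commute)
    moreover have "h' c * (y - c) \<le> h y - h c + \<epsilon> / 2 * (y - c)"
      using d2[OF y(1,4)] y(1) abs_ge_minus_self[of "h y - h c - h' c * (y - c)"] by simp
    ultimately have "norm (u y - u c) \<le> h y - h c + \<epsilon> * (y - c)"
      by (simp add: field_simps)
    moreover have "norm (u y - u a) \<le> norm (u y - u c) + norm (u c - u a)"
      using norm_triangle_ineq[of "u y - u c" "u c - u a"] by simp
    ultimately have "k y \<le> k c"
      by (simp add: k_def algebra_simps)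
    then have "y \<in> S"
      using \<open>k c \<le> 0\<close> y \<open>a \<le> c\<close> by (simp add: S_def)
    with c(2) y(1) show False by force
  qed
  with c(1) \<open>\<epsilon> * (b - a) \<le> e\<close> show "norm (u b - u a) \<le> h b - h a + e"
    by (simp add: S_def k_def)
qed

section \<open>Orbits of a strongly continuous semigroup\<close>

lemma generator_tendsto:
  assumes "x \<in> generator_domain T"
  shows "((\<lambda>t. (blinfun_apply (T t) x - x) /\<^sub>R t) \<longlongrightarrow> generator T x) (at_right 0)"
  using assms tendsto_Lim[OF trivial_limit_at_right_real]
  unfolding generator_domain_def generator_def by blast

text \<open>
  To the right of \<open>t\<close> the orbit is the image under the bounded operator \<open>T t\<close> of its
  initial piece, so the difference quotient at \<open>0\<close> is merely transported by \<open>T t\<close>.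
\<close>

lemma semigroup_orbit_right_derivative:
  assumes "strongly_continuous_semigroup T" and "x \<in> generator_domain T" and "t \<ge> 0"
  shows "((\<lambda>s. blinfun_apply (T s) x) has_vector_derivative blinfun_apply (T t) (generator T x))
           (at_right t)"
proof -
  define q where "q h = blinfun_apply (T t) ((blinfun_apply (T h) x - x) /\<^sub>R h - generator T x)"
    for h
  have "((\<lambda>h. (blinfun_apply (T h) x - x) /\<^sub>R h - generator T x) \<longlongrightarrow> 0) (at_right 0)"
    using tendsto_diff[OF generator_tendsto[OF assms(2)] tendsto_const[of "generator T x"]]
    by simp
  from blinfun.tendsto[OF tendsto_const this, of "T t"] have "(q \<longlongrightarrow> 0) (at_right 0)"
    by (simp add: q_def [abs_def])
  then have lim: "((\<lambda>z. q (z - t)) \<longlongrightarrow> 0) (at_right t)"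
    unfolding filterlim_at_right_to_0[of _ _ t] by simp
  have "q (z - t) = (1 / norm (z - t)) *\<^sub>R (blinfun_apply (T z) x -
      (blinfun_apply (T t) x + (z - t) *\<^sub>R blinfun_apply (T t) (generator T x)))" if "z > t" for z
  proof -
    have "T (t + (z - t)) = T t o\<^sub>L T (z - t)"
      using assms(1,3) that unfolding strongly_continuous_semigroup_def
      by (metis diff_ge_0_iff_ge less_imp_le)
    then have "blinfun_apply (T z) x = blinfun_apply (T t) (blinfun_apply (T (z - t)) x)"
      by simp
    with that show ?thesis
      by (simp add: q_def blinfun.diff_right blinfun.scaleR_right blinfun.add_right
          scaleR_add_right scaleR_diff_right inverse_eq_divide)
  qed
  then have "\<forall>\<^sub>F z in at_right t. q (z - t) = (1 / norm (z - t)) *\<^sub>R (blinfun_apply (T z) x -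
      (blinfun_apply (T t) x + (z - t) *\<^sub>R blinfun_apply (T t) (generator T x)))"
    using eventually_at_right_less[of t] by (rule eventually_mono[rotated])
  with lim have "((\<lambda>z. (1 / norm (z - t)) *\<^sub>R (blinfun_apply (T z) x -
      (blinfun_apply (T t) x + (z - t) *\<^sub>R blinfun_apply (T t) (generator T x)))) \<longlongrightarrow> 0)
      (at_right t)"
    by (rule Lim_transform_eventually)
  then show ?thesis
    unfolding has_vector_derivative_def has_derivative_within
    by (simp add: bounded_linear_scaleR_left)
qed

text \<open>
  Taylor's formula with a majorant \<open>\<psi>\<close>: along \<open>s \<mapsto> T s x + (t - s) T s A x\<close>, which runs from
  \<open>x + t A x\<close> to \<open>T t x\<close>, the derivative telescopes to \<open>(t - s) T s A\<^sup>2 x\<close>; the same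
  expression for \<open>\<psi>\<close> has derivative \<open>(t - s) \<psi>'' s\<close>.
\<close>

lemma semigroup_taylor_remainder_le:
  fixes \<psi> \<psi>' \<psi>'' :: "real \<Rightarrow> real"
  assumes T: "strongly_continuous_semigroup T" and x: "x \<in> generator_sq_domain T" and "t \<ge> 0"
    and d\<psi>: "\<And>s. s \<ge> 0 \<Longrightarrow> (\<psi> has_real_derivative \<psi>' s) (at s within {0..})"
    and d\<psi>': "\<And>s. s \<ge> 0 \<Longrightarrow> (\<psi>' has_real_derivative \<psi>'' s) (at s within {0..})"
    and le: "\<And>s. s \<ge> 0 \<Longrightarrow> norm (blinfun_apply (T s) (generator T (generator T x))) \<le> \<psi>'' s"
  shows "norm (blinfun_apply (T t) x - (x + t *\<^sub>R generator T x)) \<le> \<psi> t - (\<psi> 0 + t * \<psi>' 0)"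
proof -
  let ?A = "generator T"
  define u where "u s = blinfun_apply (T s) x + (t - s) *\<^sub>R blinfun_apply (T s) (?A x)" for s
  define h where "h s = \<psi> s + (t - s) * \<psi>' s" for s
  have x': "x \<in> generator_domain T" "?A x \<in> generator_domain T"
    using x by (auto simp: generator_sq_domain_def)
  have orbit: "continuous_on {0..t} (\<lambda>s. blinfun_apply (T s) y)" for y
  proof (rule continuous_on_subset)
    show "continuous_on {0..} (\<lambda>s. blinfun_apply (T s) y)"
      using T by (simp add: strongly_continuous_semigroup_def)
  qed auto
  have cont: "continuous_on {0..t} \<psi>" "continuous_on {0..t} \<psi>'"
    by (rule continuous_on_subset[of "{0..}"], rule DERIV_continuous_on, rule d\<psi>, simp, simp)
       (rule continuous_on_subset[of "{0..}"], rule DERIV_continuous_on, rule d\<psi>', simp, simp)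
  have right: "(\<psi> has_real_derivative \<psi>' s) (at_right s)"
      "(\<psi>' has_real_derivative \<psi>'' s) (at_right s)" if "s \<ge> 0" for s
    using that by (auto intro: DERIV_subset[OF d\<psi>] DERIV_subset[OF d\<psi>'])
  have "norm (u t - u 0) \<le> h t - h 0"
  proof (rule norm_diff_le_of_right_derivative_le[OF \<open>t \<ge> 0\<close>])
    show "continuous_on {0..t} u"
      unfolding u_def by (intro continuous_intros orbit)
    show "continuous_on {0..t} h"
      unfolding h_def by (intro continuous_intros cont)
  next
    fix s assume s: "0 \<le> s" "s < t"
    show "(u has_vector_derivative (t - s) *\<^sub>R blinfun_apply (T s) (?A (?A x))) (at_right s)"
      unfolding u_def
      by (rule has_vector_derivative_eq_rhs)
         (auto intro!: derivative_eq_intros semigroup_orbit_right_derivative[OF T] x' s)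
    show "(h has_real_derivative (t - s) * \<psi>'' s) (at_right s)"
      unfolding h_def using right[OF s(1)] by (auto intro!: derivative_eq_intros)
    show "norm ((t - s) *\<^sub>R blinfun_apply (T s) (?A (?A x))) \<le> (t - s) * \<psi>'' s"
      using le[OF s(1)] s by (simp add: mult_left_mono)
  qed
  moreover have "T 0 = id_blinfun"
    using T by (simp add: strongly_continuous_semigroup_def)
  ultimately show ?thesis
    by (simp add: u_def h_def)
qed

section \<open>The inequality between the norms\<close>

text \<open>
  The first inequality alone would suffice if \<open>a \<le> c\<close> were known. The behaviour of the
  second one near \<open>0\<close> and of the first one near \<open>\<infinity>\<close> places \<open>b\<close> between \<open>a\<close> and \<open>c\<close>.
\<close>

lemma square_le_of_taylor_inequalities:
  fixes a b c :: real and \<phi> :: "real \<Rightarrow> real"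
  assumes "a > 0" "c \<ge> 0"
    and \<phi>_le_1: "\<And>s. s \<ge> 0 \<Longrightarrow> \<phi> s \<le> 1"
    and \<phi>_le: "\<And>s. s \<ge> 0 \<Longrightarrow> \<phi> s \<le> 1 - s + s\<^sup>2 / 2"
    and upper: "\<And>s. s \<ge> 0 \<Longrightarrow> s * b \<le> a + \<phi> s * a + c * (\<phi> s - 1 + s)"
    and lower: "\<And>s. s \<ge> 0 \<Longrightarrow> a \<le> s * b + \<phi> s * a + c * (\<phi> s - 1 + s)"
  shows "b\<^sup>2 \<le> 4 * a * c"
proof -
  have "a \<le> b"
  proof (rule ccontr)
    assume "\<not> a \<le> b"
    (* At this point the quadratic error term is half of the linear term s * (a - b). *)
    define s where "s = (a - b) / (a + c)"
    have "s > 0" "s * (a + c) = a - b"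
      using \<open>\<not> a \<le> b\<close> \<open>a > 0\<close> \<open>c \<ge> 0\<close> by (auto simp: s_def)
    have "\<phi> s * (a + c) \<le> (1 - s + s\<^sup>2 / 2) * (a + c)"
      using \<phi>_le[of s] \<open>s > 0\<close> \<open>a > 0\<close> \<open>c \<ge> 0\<close> by (intro mult_right_mono) auto
    then have "s * (a - b) \<le> s * (s * (a + c) / 2)"
      using lower[of s] \<open>s > 0\<close> by (simp add: field_simps power2_eq_square)
    then have "a - b \<le> (a - b) / 2"
      using \<open>s > 0\<close> \<open>s * (a + c) = a - b\<close> by simp
    with \<open>\<not> a \<le> b\<close> show False by simp
  qed
  moreover have "b \<le> c"
  proof (rule ccontr)
    assume "\<not> b \<le> c"
    (* The right-hand side of the first inequality exceeds s * c by at most 2 * a. *)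
    define s where "s = 3 * a / (b - c)"
    have "s > 0" "s * (b - c) = 3 * a"
      using \<open>\<not> b \<le> c\<close> \<open>a > 0\<close> by (auto simp: s_def)
    have "\<phi> s * (a + c) \<le> 1 * (a + c)"
      using \<phi>_le_1[of s] \<open>s > 0\<close> \<open>a > 0\<close> \<open>c \<ge> 0\<close> by (intro mult_right_mono) auto
    then have "s * (b - c) \<le> 2 * a"
      using upper[of s] \<open>s > 0\<close> by (simp add: algebra_simps)
    with \<open>s * (b - c) = 3 * a\<close> \<open>a > 0\<close> show False by simp
  qed
  ultimately have "a \<le> c" "b > 0" "c > 0"
    using \<open>a > 0\<close> by auto
  (* This s minimises 2 * a / s + s * c / 2; as s is at most 2, the term a * s * (s - 2) / 2
     that remains from the upper bound for \<phi> has the favourable sign. *)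
  define s where "s = 2 * sqrt (a / c)"
  have "s > 0" "s \<le> 2" "s\<^sup>2 * c = 4 * a"
    using \<open>a \<le> c\<close> \<open>a > 0\<close> \<open>c > 0\<close> by (auto simp: s_def power_mult_distrib)
  have "\<phi> s * (a + c) \<le> (1 - s + s\<^sup>2 / 2) * (a + c)"
    using \<phi>_le[of s] \<open>s > 0\<close> \<open>a > 0\<close> \<open>c > 0\<close> by (intro mult_right_mono) auto
  then have "s * b \<le> 2 * a + s\<^sup>2 * c / 2 + a * (s * (s - 2) / 2)"
    using upper[of s] \<open>s > 0\<close> by (simp add: field_simps power2_eq_square)
  also have "a * (s * (s - 2) / 2) \<le> 0"
    using \<open>s > 0\<close> \<open>s \<le> 2\<close> \<open>a > 0\<close> by (simp add: mult_nonneg_nonpos)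
  finally have "s * b \<le> 4 * a"
    using \<open>s\<^sup>2 * c = 4 * a\<close> by simp
  then have "(s * b)\<^sup>2 \<le> (4 * a)\<^sup>2"
    using \<open>s > 0\<close> \<open>b > 0\<close> by (intro power_mono) auto
  then have "s\<^sup>2 * c * b\<^sup>2 \<le> 16 * a\<^sup>2 * c"
    using \<open>c > 0\<close> by (simp add: power_mult_distrib mult_right_mono mult.assoc mult.left_commute)
  then have "(4 * a) * b\<^sup>2 \<le> (4 * a) * (4 * a * c)"
    unfolding \<open>s\<^sup>2 * c = 4 * a\<close> by (simp add: power2_eq_square mult_ac)
  then show ?thesis
    using \<open>a > 0\<close> by (simp only: mult_le_cancel_left_pos)
qed

theorem theorem1p1:
  fixes \<phi> \<phi>' \<phi>'' :: "real \<Rightarrow> real"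
    and T :: "real \<Rightarrow> 'a::banach \<Rightarrow>\<^sub>L 'a"
    and f :: 'a
    and \<omega> a b c :: real
  assumes "\<And>t. t \<ge> 0 \<Longrightarrow> (\<phi> has_real_derivative \<phi>' t) (at t within {0..})"
    and "\<And>t. t \<ge> 0 \<Longrightarrow> (\<phi>' has_real_derivative \<phi>'' t) (at t within {0..})"
    and "continuous_on {0..} \<phi>''"
    and "\<And>t. t \<ge> 0 \<Longrightarrow> \<phi> t > 0"
    and "antimono_on {0..} \<phi>"
    and "convex_on {0..} \<phi>"
    and "\<phi> 0 = 1" and "- \<phi>' 0 = 1"
    and "\<And>t. t \<ge> 0 \<Longrightarrow> \<phi> t \<le> 1 - t + t\<^sup>2 / 2"
    and "strongly_continuous_semigroup T"
    and "f \<in> generator_sq_domain T - {0}"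
    and "\<omega> > 0"
    and "\<And>t. t \<ge> 0 \<Longrightarrow> norm (blinfun_apply (T t) f) \<le> \<phi> (\<omega> * t) * norm f"
    and "\<And>t. t \<ge> 0 \<Longrightarrow> norm (blinfun_apply (T t) (generator T (generator T f)))
           \<le> \<phi>'' (\<omega> * t) * norm (generator T (generator T f))"
    and "a = norm f"
    and "b = norm (generator T f) / \<omega>"
    and "c = norm (generator T (generator T f)) / \<omega>\<^sup>2"
  shows "(\<forall>s\<ge>0. \<phi> s * (a + c) + s * (c - b) + (a - c) \<ge> 0) \<and> b\<^sup>2 \<le> 4 * a * c"
proof -
  let ?A = "generator T"
  note d\<phi> = assms(1) and d\<phi>' = assms(2) and \<phi>_le = assms(9) and T = assms(10)
    and Tf = assms(13) and TAAf = assms(14) and \<omega> = assms(12)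
    and a = assms(15) and b = assms(16) and c = assms(17)
  have f: "f \<in> generator_sq_domain T" "f \<noteq> 0"
    using assms(11) by auto
  then have "a > 0" "c \<ge> 0"
    by (auto simp: a c)
  have \<phi>_le_1: "\<phi> s \<le> 1" if "s \<ge> 0" for s
    using monotone_onD[OF assms(5), of 0 s] that assms(7) by simp

  have remainder: "norm (blinfun_apply (T (s / \<omega>)) f - (f + (s / \<omega>) *\<^sub>R ?A f))
      \<le> c * (\<phi> s - 1 + s)" if "s \<ge> 0" for s
  proof -
    define \<psi> where "\<psi> r = c * \<phi> (\<omega> * r)" for r
    define \<psi>' where "\<psi>' r = c * (\<omega> * \<phi>' (\<omega> * r))" for r
    define \<psi>'' where "\<psi>'' r = norm (?A (?A f)) * \<phi>'' (\<omega> * r)" for r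
    have scale: "((\<lambda>r. g (\<omega> * r)) has_real_derivative \<omega> * g' (\<omega> * r)) (at r within {0..})"
      if "\<And>r. r \<ge> 0 \<Longrightarrow> (g has_real_derivative g' r) (at r within {0..})" "r \<ge> 0" for g g' r
    proof -
      have "(g has_real_derivative g' (\<omega> * r)) (at (\<omega> * r) within (*) \<omega> ` {0..})"
        using that \<omega> by (intro DERIV_subset[OF that(1)]) auto
      moreover have "((*) \<omega> has_real_derivative \<omega>) (at r within {0..})"
        by (auto intro!: derivative_eq_intros)
      ultimately show ?thesis
        using DERIV_image_chain[of g "g' (\<omega> * r)" "(*) \<omega>" r "{0..}" \<omega>]
        by (simp add: o_def mult.commute[of "g' _"])
    qed
    have "norm (blinfun_apply (T (s / \<omega>)) f - (f + (s / \<omega>) *\<^sub>R ?A f))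
        \<le> \<psi> (s / \<omega>) - (\<psi> 0 + (s / \<omega>) * \<psi>' 0)"
    proof (rule semigroup_taylor_remainder_le[OF T f(1)])
      fix r :: real assume "r \<ge> 0"
      show "(\<psi> has_real_derivative \<psi>' r) (at r within {0..})"
        unfolding \<psi>_def \<psi>'_def by (intro DERIV_cmult scale d\<phi> \<open>r \<ge> 0\<close>)
      have "(\<psi>' has_real_derivative c * (\<omega> * (\<omega> * \<phi>'' (\<omega> * r)))) (at r within {0..})"
        unfolding \<psi>'_def by (intro DERIV_cmult scale d\<phi>' \<open>r \<ge> 0\<close>)
      then show "(\<psi>' has_real_derivative \<psi>'' r) (at r within {0..})"
        using \<omega> by (simp add: \<psi>''_def c power2_eq_square)
      show "norm (blinfun_apply (T r) (?A (?A f))) \<le> \<psi>'' r"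
        using TAAf[OF \<open>r \<ge> 0\<close>] by (simp add: \<psi>''_def mult.commute)
    qed (use \<open>s \<ge> 0\<close> \<omega> in simp)
    also have "\<dots> = c * (\<phi> s - 1 + s)"
      using \<omega> assms(7,8) by (simp add: \<psi>_def \<psi>'_def algebra_simps)
    finally show ?thesis .
  qed
  have orbit: "norm (blinfun_apply (T (s / \<omega>)) f) \<le> \<phi> s * a" if "s \<ge> 0" for s
    using Tf[of "s / \<omega>"] that \<omega> by (simp add: a)
  have linear_term: "norm ((s / \<omega>) *\<^sub>R ?A f) = s * b" if "s \<ge> 0" for s
    using that \<omega> by (simp add: b)
  have upper: "s * b \<le> a + \<phi> s * a + c * (\<phi> s - 1 + s)" if "s \<ge> 0" for s
  proof -
    define y v where "y = blinfun_apply (T (s / \<omega>)) f" and "v = (s / \<omega>) *\<^sub>R ?A f"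
    have "norm v = norm ((y - f) - (y - (f + v)))"
      by simp
    also have "\<dots> \<le> norm y + norm f + norm (y - (f + v))"
      by (intro order_trans[OF norm_triangle_ineq4] add_right_mono norm_triangle_ineq4)
    finally show ?thesis
      using remainder[OF that] orbit[OF that] linear_term[OF that] by (simp add: y_def v_def a)
  qed
  have lower: "a \<le> s * b + \<phi> s * a + c * (\<phi> s - 1 + s)" if "s \<ge> 0" for s
  proof -
    define y v where "y = blinfun_apply (T (s / \<omega>)) f" and "v = (s / \<omega>) *\<^sub>R ?A f"
    have "norm f = norm ((y - v) - (y - (f + v)))"
      by simp
    also have "\<dots> \<le> norm y + norm v + norm (y - (f + v))"
      by (intro order_trans[OF norm_triangle_ineq4] add_right_mono norm_triangle_ineq4)
    finally show ?thesis
      using remainder[OF that] orbit[OF that] linear_term[OF that] by (simp add: y_def v_def a)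
  qed
  have "\<phi> s * (a + c) + s * (c - b) + (a - c) \<ge> 0" if "s \<ge> 0" for s
    using upper[OF that] by (simp add: algebra_simps)
  moreover have "b\<^sup>2 \<le> 4 * a * c"
    using square_le_of_taylor_inequalities[OF \<open>a > 0\<close> \<open>c \<ge> 0\<close> \<phi>_le_1 \<phi>_le upper lower] .
  ultimately show ?thesis by blast
qed

end
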